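(* Let $\mu$ be a probability measure on $\mathbb{R}$ satisfying the standing assumptions below and $\int_{\mathbb{R}}|x|\,d\mu<+\infty$, and let $\{y_j\}_{j\in[k]}$ (with $y_1\le\dots\le y_k$) be the support of a solution to $\min_{\lambda\in\mathcal{P}_k(\mathbb{R})}W_1(\mu,\lambda)$. Then the vector $\vec v_\mu$ defined by $(v_\mu)_j=F_\mu(y_j)$, $j\in[k]$, is an optimal percentile vector, i.e. $\lim_{n\to\infty}B^{(n)}_{ar}(\mathcal{PM}_{\vec v_\mu})=1$.
   Context: For $\vec x\in\mathbb{R}^n$, $\vec y\in\mathbb{R}^k$: $SC(\vec x,\vec y)=\frac1n\sum_i\min_j|x_i-y_j|$, $SC_{opt}(\vec x)=\min_{\vec y}SC(\vec x,\vec y)$. A percentile vector is $\vec v$ with $0\le v_1\le\dots\le v_k\le1$; $\mathcal{PM}_{\vec v}$ sorts the reports $x_{(1)}\le\dots\le x_{(n)}$ and places facility $j$ at $x_{(\lfloor(n-1)v_j\rfloor+1)}$. With $\vec X_n$ a vector of $n$ i.i.d. variables of law $\mu$, $B^{(n)}_{ar}(f)=\mathbb{E}[SC_f(\vec X_n)]/\mathbb{E}[SC_{opt}(\vec X_n)]$. A percentile vector is optimal for $\mu$ if the limit of $B^{(n)}_{ar}$ of its mechanism is $1$. $\mathcal{P}_k(\mathbb{R})$: probability measures $\sum_{j=1}^k\nu_j\delta_{x_j}$. $W_1$: 1-Wasserstein distance. $F_\mu$: c.d.f. of $\mu$. Standing assumptions on $\mu$: absolutely continuous with density $\rho_\mu$;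 support an interval on whose interior $\rho_\mu>0$; $\rho_\mu$ differentiable on the support. *)

theory Defs
  imports "HOL-Probability.Probability"
begin

definition SC :: "nat \<Rightarrow> nat \<Rightarrow> (nat \<Rightarrow> real) \<Rightarrow> (nat \<Rightarrow> real) \<Rightarrow> real" where
  "SC n k x y = (\<Sum>i<n. Min ((\<lambda>j. \<bar>x i - y j\<bar>) ` {..<k})) / real n"

definition SC_opt :: "nat \<Rightarrow> nat \<Rightarrow> (nat \<Rightarrow> real) \<Rightarrow> real" where
  "SC_opt n k x = (INF y. SC n k x y)"

text \<open>Percentile mechanism (0-based indices): facility j is placed at the
  order statistic x_(floor((n-1) v_j) + 1).\<close>
definition percentile_mech :: "(nat \<Rightarrow> real) \<Rightarrow> nat \<Rightarrow> (nat \<Rightarrow> real) \<Rightarrow> (nat \<Rightarrow> real)" where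
  "percentile_mech v n x = (\<lambda>j. sort (map x [0..<n]) ! nat \<lfloor>real (n - 1) * v j\<rfloor>)"

definition B_ar :: "real measure \<Rightarrow> nat \<Rightarrow> nat \<Rightarrow> (nat \<Rightarrow> (nat \<Rightarrow> real) \<Rightarrow> (nat \<Rightarrow> real)) \<Rightarrow> real" where
  "B_ar \<mu> k n f =
     (\<integral>x. SC n k x (f n x) \<partial>(PiM {..<n} (\<lambda>_. \<mu>))) /
     (\<integral>x. SC_opt n k x \<partial>(PiM {..<n} (\<lambda>_. \<mu>)))"

definition couplings :: "real measure \<Rightarrow> real measure \<Rightarrow> (real \<times> real) measure set" where
  "couplings \<mu> \<nu> = {\<pi>. sets \<pi> = sets (borel \<Otimes>\<^sub>M borel) \<and> prob_space \<pi> \<and>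
       distr \<pi> borel fst = \<mu> \<and> distr \<pi> borel snd = \<nu>}"

definition W1 :: "real measure \<Rightarrow> real measure \<Rightarrow> ennreal" where
  "W1 \<mu> \<nu> = (INF \<pi> \<in> couplings \<mu> \<nu>. \<integral>\<^sup>+ p. ennreal \<bar>fst p - snd p\<bar> \<partial>\<pi>)"

definition Pk :: "nat \<Rightarrow> real measure set" where
  "Pk k = {L. sets L = sets borel \<and>
     (\<exists>\<nu> x. (\<forall>j<k. \<nu> j \<ge> 0) \<and> (\<Sum>j<k. \<nu> j) = 1 \<and>
        (\<forall>A \<in> sets borel. emeasure L A = (\<Sum>j<k. ennreal (\<nu> j) * indicator A (x j))))}"

definition msupport :: "real measure \<Rightarrow> real set" where
  "msupport M = {x. \<forall>e>0. emeasure M (ball x e) > 0}"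

definition cdf :: "real measure \<Rightarrow> real \<Rightarrow> real" where
  "cdf M t = measure M {..t}"

definition optimal_percentile :: "real measure \<Rightarrow> nat \<Rightarrow> (nat \<Rightarrow> real) \<Rightarrow> bool" where
  "optimal_percentile \<mu> k v \<longleftrightarrow>
     (\<forall>j<k. 0 \<le> v j \<and> v j \<le> 1) \<and> (\<forall>i j. i \<le> j \<longrightarrow> j < k \<longrightarrow> v i \<le> v j) \<and>
     (\<lambda>n. B_ar \<mu> k n (percentile_mech v)) \<longlonglongrightarrow> 1"

definition standing_assms :: "real measure \<Rightarrow> (real \<Rightarrow> real) \<Rightarrow> bool" where
  "standing_assms \<mu> \<rho> \<longleftrightarrow>
     prob_space \<mu> \<and> \<rho> \<in> borel_measurable borel \<and> (\<forall>x. \<rho> x \<ge> 0) \<and>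
     \<mu> = density lborel (\<lambda>x. ennreal (\<rho> x)) \<and>
     is_interval (msupport \<mu>) \<and>
     (\<forall>x \<in> interior (msupport \<mu>). \<rho> x > 0) \<and>
     (\<forall>x \<in> msupport \<mu>. \<rho> differentiable (at x within msupport \<mu>))"

end

theory Submission
  imports Defs
begin

text \<open>
  Write \<open>m\<close> for the mean distance of a point drawn from \<open>\<mu>\<close> to its nearest facility among the \<open>y\<^sub>j\<close>.
  Since a coupling of \<open>\<mu>\<close> with a measure supported on \<open>k\<close> points costs at least the mean distance
  to these points, and the nearest-point coupling attains this, \<open>m\<close> is minimal among all placements.

  Empirical means of all 1-Lipschitz functions differ from their expectations by at most one
  random variable \<open>U\<^sub>n\<close> with \<open>E U\<^sub>n \<rightarrow> 0\<close>: replace the identity by a simple function that is close to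
  it in \<open>L\<^sup>1(\<mu>)\<close> and bound the variance on each of its finitely many level sets. As the distance to the
  nearest facility is 1-Lipschitz, the optimal cost is at least \<open>m - U\<^sub>n\<close>. A truncated linear test
  function shows that a sample percentile at level \<open>F(p)\<close> lies within \<open>\<epsilon> + 2 U\<^sub>n / \<delta>\<close> of \<open>p\<close> if \<open>F\<close>
  grows by \<open>\<delta>\<close> on both sides of \<open>p\<close>, so the cost of the mechanism is at most
  \<open>m + \<epsilon> + (1 + 2 / \<delta>) U\<^sub>n\<close>. Facilities outside the support of \<open>\<mu>\<close>, where \<open>F\<close> is flat, are first
  projected to it; this changes neither their percentiles nor increases the cost.
\<close>

section \<open>Coordinates of an i.i.d. sample\<close>

lemma (in real_distribution)
  fixes f :: "real \<Rightarrow> real"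
  assumes "f \<in> borel_measurable borel" and "i < n"
  shows integral_PiM_component: "(\<integral>x. f (x i) \<partial>PiM {..<n} (\<lambda>_. M)) = (\<integral>t. f t \<partial>M)"
    and integrable_PiM_component: "integrable (PiM {..<n} (\<lambda>_. M)) (\<lambda>x. f (x i)) \<longleftrightarrow> integrable M f"
proof -
  have M: "distr (PiM {..<n} (\<lambda>_. M)) M (\<lambda>x. x i) = M"
    using distr_PiM_component[of "{..<n}" "\<lambda>_. M" i] assms(2) prob_space_axioms by auto
  have [measurable]: "f \<in> borel_measurable M" "(\<lambda>x. x i) \<in> PiM {..<n} (\<lambda>_. M) \<rightarrow>\<^sub>M M"
    using assms by auto
  show "(\<integral>x. f (x i) \<partial>PiM {..<n} (\<lambda>_. M)) = (\<integral>t. f t \<partial>M)"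
    by (subst (2) M[symmetric], subst integral_distr) auto
  show "integrable (PiM {..<n} (\<lambda>_. M)) (\<lambda>x. f (x i)) \<longleftrightarrow> integrable M f"
    by (subst (2) M[symmetric], subst integrable_distr_eq) auto
qed

lemma (in real_distribution) prob_space_sample: "prob_space (PiM {..<n::nat} (\<lambda>_. M))"
  by (intro prob_space_PiM prob_space_axioms)

lemma (in real_distribution) AE_sample:
  assumes "AE t in M. P t"
  shows "AE x in PiM {..<n::nat} (\<lambda>_. M). \<forall>i<n. P (x i)"
proof -
  have "AE x in PiM {..<n} (\<lambda>_. M). \<forall>i\<in>{..<n}. P (x i)"
    using assms by (intro AE_finite_allI AE_PiM_component prob_space_axioms) auto
  then show ?thesis by (auto elim: AE_mp)
qed

section \<open>A law of large numbers uniform over 1-Lipschitz functions\<close>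

text \<open>By independence the mixed terms of the squared mean integrate to zero, so its second
  moment is at most \<open>1 / n\<close>. A weighted arithmetic-geometric inequality passes from the
  second moment to the first.\<close>

lemma (in real_distribution) expectation_abs_mean_centered:
  fixes h :: "real \<Rightarrow> real" and n :: nat
  assumes [measurable]: "h \<in> borel_measurable borel" and bd: "\<And>t. \<bar>h t\<bar> \<le> 1"
    and mean: "(\<integral>t. h t \<partial>M) = 0" and n: "n \<ge> 1"
  shows "integrable (PiM {..<n} (\<lambda>_. M)) (\<lambda>x. \<bar>(\<Sum>i<n. h (x i)) / n\<bar>)" (is ?int)
    and "(\<integral>x. \<bar>(\<Sum>i<n. h (x i)) / n\<bar> \<partial>PiM {..<n} (\<lambda>_. M)) \<le> 1 / sqrt n" (is ?bound)
proof -
  let ?P = "PiM {..<n} (\<lambda>_. M)"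
  interpret P: prob_space ?P by (rule prob_space_sample)
  interpret product_sigma_finite "\<lambda>_::nat. M"
    by standard (use sigma_finite_measure_axioms in \<open>auto simp: sigma_finite_measure_def\<close>)
  have [measurable]: "(\<lambda>x. h (x i)) \<in> borel_measurable ?P" if "i < n" for i
    using that by (intro measurable_compose[OF measurable_component_singleton]) auto
  have int1: "integrable ?P (\<lambda>x. h (x i) * h (x j))" if "i < n" "j < n" for i j
  proof (rule P.integrable_const_bound[of _ 1])
    show "AE x in ?P. norm (h (x i) * h (x j)) \<le> 1"
      using mult_mono[OF bd bd] by (auto simp: abs_mult)
    show "(\<lambda>x. h (x i) * h (x j)) \<in> borel_measurable ?P" using that by simp
  qed
  have hh: "h s * h t \<le> 1" for s t
    using mult_mono[OF bd bd, of t s] abs_ge_self[of "h s * h t"] by (simp add: abs_mult)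
  have cross: "(\<integral>x. h (x i) * h (x j) \<partial>?P) \<le> (if i = j then 1 else 0)" if ij: "i < n" "j < n" for i j
  proof (cases "i = j")
    case True
    have "(\<integral>x. h (x i) * h (x j) \<partial>?P) \<le> (\<integral>x. 1 \<partial>?P)"
      using int1[OF ij] hh by (intro integral_mono) auto
    then show ?thesis using True by (simp add: P.prob_space)
  next
    case False
    \<comment> \<open>The two factors are padded with the constant 1 to a product over all
      coordinates, the form in which the integral factorises.\<close>
    have "(\<lambda>x. h (x i) * h (x j)) = (\<lambda>x. \<Prod>l<n. (if l = i \<or> l = j then h else (\<lambda>_. 1)) (x l))"
    proof
      fix x
      have "(\<Prod>l<n. (if l = i \<or> l = j then h else (\<lambda>_. 1)) (x l)) = (\<Prod>l\<in>{i, j}. h (x l))"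
        using ij by (intro prod.mono_neutral_cong_right) auto
      then show "h (x i) * h (x j) = (\<Prod>l<n. (if l = i \<or> l = j then h else (\<lambda>_. 1)) (x l))"
        using False by simp
    qed
    then have "(\<integral>x. h (x i) * h (x j) \<partial>?P) =
        (\<integral>x. (\<Prod>l<n. (if l = i \<or> l = j then h else (\<lambda>_. 1)) (x l)) \<partial>?P)"
      by (rule arg_cong)
    also have "\<dots> = (\<Prod>l<n. \<integral>t. (if l = i \<or> l = j then h else (\<lambda>_. 1)) t \<partial>M)"
      using bd by (intro product_integral_prod) (auto intro!: integrable_const_bound[of _ 1])
    also have "\<dots> = 0"
      using ij mean by (intro prod_zero) auto
    finally show ?thesis using False by simp
  qed
  define Y where "Y x = (\<Sum>i<n. h (x i)) / n" for x
  have sq: "(Y x)\<^sup>2 = (\<Sum>i<n. \<Sum>j<n. h (x i) * h (x j)) / n\<^sup>2" for x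
    by (simp add: Y_def power_divide power2_eq_square sum_product)
  have intsq: "integrable ?P (\<lambda>x. (Y x)\<^sup>2)"
    unfolding sq by (intro integrable_divide_zero Bochner_Integration.integrable_sum int1) auto
  have "(\<integral>x. (Y x)\<^sup>2 \<partial>?P) = (\<Sum>i<n. \<Sum>j<n. \<integral>x. h (x i) * h (x j) \<partial>?P) / n\<^sup>2"
    unfolding sq
    by (subst integral_divide_zero, subst Bochner_Integration.integral_sum)
       (auto intro!: int1 sum.cong Bochner_Integration.integral_sum)
  also have "\<dots> \<le> (\<Sum>i<n. \<Sum>j<n. if i = j then 1 else 0) / n\<^sup>2"
    using cross by (intro divide_right_mono sum_mono) auto
  also have "\<dots> = 1 / n" using n by (simp add: power2_eq_square)
  finally have ev: "(\<integral>x. (Y x)\<^sup>2 \<partial>?P) \<le> 1 / n" .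
  define r where "r = sqrt n"
  have r: "r > 0" "real n = r * r" using n by (auto simp: r_def)
  \<comment> \<open>This is \<open>(r * \<bar>Y x\<bar> - 1)\<^sup>2 \<ge> 0\<close> rearranged. The
    choice \<open>r = sqrt n\<close> balances the two terms: after integration each contributes at
    most \<open>1 / (2 * r)\<close>.\<close>
  have absY: "\<bar>Y x\<bar> \<le> (r * (Y x)\<^sup>2 + 1 / r) / 2" for x
  proof -
    have "(r * \<bar>Y x\<bar> - 1)\<^sup>2 = r * r * (Y x)\<^sup>2 - 2 * r * \<bar>Y x\<bar> + 1"
      by (simp add: power2_diff power_mult_distrib power2_eq_square[of r])
    then have "2 * r * \<bar>Y x\<bar> \<le> r * r * (Y x)\<^sup>2 + 1"
      using zero_le_power2[of "r * \<bar>Y x\<bar> - 1"] by linarith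
    then show ?thesis using r(1) by (simp add: field_simps)
  qed
  have meas: "Y \<in> borel_measurable ?P" unfolding Y_def by measurable
  have intb: "integrable ?P (\<lambda>x. (r * (Y x)\<^sup>2 + 1 / r) / 2)" using intsq by simp
  have i: "integrable ?P (\<lambda>x. \<bar>Y x\<bar>)"
  proof (rule Bochner_Integration.integrable_bound[OF intb])
    show "AE x in ?P. norm \<bar>Y x\<bar> \<le> norm ((r * (Y x)\<^sup>2 + 1 / r) / 2)"
      unfolding real_norm_def abs_idempotent by (intro AE_I2 order_trans[OF absY abs_ge_self])
  qed (use meas in simp)
  then show ?int by (simp add: Y_def)
  have "(\<integral>x. \<bar>Y x\<bar> \<partial>?P) \<le> (\<integral>x. (r * (Y x)\<^sup>2 + 1 / r) / 2 \<partial>?P)"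
    using i intb absY by (rule integral_mono)
  also have "\<dots> = (r * (\<integral>x. (Y x)\<^sup>2 \<partial>?P) + 1 / r) / 2"
    using intsq by (simp add: P.prob_space)
  also have "\<dots> \<le> (r * (1 / n) + 1 / r) / 2"
    using ev r(1) by (intro divide_right_mono add_right_mono mult_left_mono) auto
  also have "\<dots> = 1 / r" using r by (simp add: field_simps)
  finally show ?bound by (simp add: Y_def r_def)
qed

text \<open>Split \<open>g\<close> into \<open>g - g \<circ> s\<close> and
  \<open>g \<circ> s\<close>, where \<open>s\<close> is a simple function near the identity. The
  first part is bounded by the distance from \<open>t\<close> to \<open>s t\<close>; the second is a
  constant plus a combination of centred indicators of the finitely many level sets of
  \<open>s\<close>, with coefficients bounded by \<open>\<bar>a\<bar>\<close>. Neither bound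
  involves \<open>g\<close>, so the test function may even be chosen after the sample is
  seen.\<close>

lemma (in real_distribution) uniform_lipschitz_mean:
  fixes \<eta> :: real
  assumes int: "integrable M (\<lambda>t. t)" and \<eta>: "\<eta> > 0"
  obtains U :: "nat \<Rightarrow> (nat \<Rightarrow> real) \<Rightarrow> real" and N :: nat where "N \<ge> 1"
    and "\<And>n. n \<ge> N \<Longrightarrow> integrable (PiM {..<n} (\<lambda>_. M)) (U n)"
    and "\<And>n. n \<ge> N \<Longrightarrow> (\<integral>x. U n x \<partial>PiM {..<n} (\<lambda>_. M)) \<le> \<eta>"
    and "\<And>n x g. n \<ge> N \<Longrightarrow> 1-lipschitz_on UNIV g \<Longrightarrow>
      \<bar>(\<Sum>i<n. g (x i)) / n - (\<integral>t. g t \<partial>M)\<bar> \<le> U n x"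
proof -
  have "(\<lambda>t::real. t) \<in> borel_measurable M" by simp
  from borel_measurable_implies_sequence_metric[OF this, of 0]
  obtain S :: "nat \<Rightarrow> real \<Rightarrow> real" where S: "\<And>i. simple_function M (S i)"
      "\<And>t. (\<lambda>i. S i t) \<longlonglongrightarrow> t" "\<And>i t. \<bar>S i t\<bar> \<le> 2 * \<bar>t\<bar>"
    by (auto simp: dist_real_def)
  have [measurable]: "S i \<in> borel_measurable borel" for i
    using borel_measurable_simple_function[OF S(1), of i] by simp
  \<comment> \<open>Dominated convergence: \<open>\<bar>S i t\<bar> \<le> 2 * \<bar>t\<bar>\<close>
    bounds the difference by \<open>3 * \<bar>t\<bar>\<close>, which is integrable.\<close>
  have "(\<lambda>i. \<integral>t. \<bar>t - S i t\<bar> \<partial>M) \<longlonglongrightarrow> (\<integral>t. 0 \<partial>M)"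
  proof (rule integral_dominated_convergence)
    show "integrable M (\<lambda>t. 3 * \<bar>t\<bar>)" using int by simp
    show "AE t in M. (\<lambda>i. \<bar>t - S i t\<bar>) \<longlonglongrightarrow> 0"
    proof (rule AE_I2)
      fix t show "(\<lambda>i. \<bar>t - S i t\<bar>) \<longlonglongrightarrow> 0"
        using tendsto_rabs[OF tendsto_diff[OF tendsto_const S(2)], of t t] by simp
    qed
    show "AE t in M. norm \<bar>t - S i t\<bar> \<le> 3 * \<bar>t\<bar>" for i
    proof (rule AE_I2)
      fix t show "norm \<bar>t - S i t\<bar> \<le> 3 * \<bar>t\<bar>" using S(3)[of i t] by simp
    qed
  qed auto
  then have "\<forall>\<^sub>F i in sequentially. (\<integral>t. \<bar>t - S i t\<bar> \<partial>M) < \<eta> / 4"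
    using \<eta> by (intro order_tendstoD(2)) auto
  then obtain i0 where i0: "(\<integral>t. \<bar>t - S i0 t\<bar> \<partial>M) < \<eta> / 4"
    by (auto simp: eventually_sequentially)
  define s where "s = S i0"
  have s [measurable]: "s \<in> borel_measurable borel" by (simp add: s_def)
  have intd: "integrable M (\<lambda>t. \<bar>t - s t\<bar>)"
  proof (rule Bochner_Integration.integrable_bound[of _ "\<lambda>t. 3 * \<bar>t\<bar>"])
    show "AE t in M. norm \<bar>t - s t\<bar> \<le> norm (3 * \<bar>t\<bar>)"
    proof (rule AE_I2)
      fix t show "norm \<bar>t - s t\<bar> \<le> norm (3 * \<bar>t\<bar>)" using S(3)[of i0 t] by (simp add: s_def)
    qed
    show "integrable M (\<lambda>t. 3 * \<bar>t\<bar>)" using int by simp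
  qed measurable
  define A where "A = range s"
  have finA: "finite A" using simple_functionD(1)[OF S(1)[of i0]] by (simp add: A_def s_def)
  define h where "h a t = indicator {t. s t = a} t - prob {t. s t = a}" for a t
  have hm [measurable]: "h a \<in> borel_measurable borel" for a unfolding h_def by measurable
  have hb: "\<bar>h a t\<bar> \<le> 1" for a t
    using measure_nonneg[of M "{t. s t = a}"] prob_le_1[of "{t. s t = a}"] unfolding h_def indicator_def by auto
  have h0: "(\<integral>t. h a t \<partial>M) = 0" for a
  proof -
    have "integrable M (indicator {t. s t = a} :: real \<Rightarrow> real)"
      by (intro integrable_real_indicator) (auto simp: less_top[symmetric])
    then show ?thesis
      using prob_space unfolding h_def by (subst Bochner_Integration.integral_diff) auto
  qed
  define C where "C = (\<Sum>a\<in>A. \<bar>a\<bar>)"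
  have C0: "C \<ge> 0" by (auto simp: C_def intro: sum_nonneg)
  \<comment> \<open>The three terms bound the empirical error of replacing \<open>t\<close> by
    \<open>s t\<close>, the same error in expectation, and the fluctuation of the level set
    frequencies. Their expectations are at most \<open>\<eta> / 4\<close>, \<open>\<eta> / 4\<close>
    and \<open>\<eta> / 2\<close>.\<close>
  define U where "U n x = (\<Sum>i<n. \<bar>x i - s (x i)\<bar>) / n + \<eta> / 4 +
      (\<Sum>a\<in>A. \<bar>a\<bar> * \<bar>(\<Sum>i<n. h a (x i)) / n\<bar>)" for n :: nat and x :: "nat \<Rightarrow> real"
  \<comment> \<open>Beyond this threshold \<open>C / sqrt n \<le> \<eta> / 2\<close>; the successor
    ensures \<open>N \<ge> 1\<close>.\<close>
  define N where "N = Suc (nat \<lceil>(2 * C / \<eta>)\<^sup>2\<rceil>)"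
  have int_U: "integrable (PiM {..<n} (\<lambda>_. M)) (U n)"
    and E_U: "(\<integral>x. U n x \<partial>PiM {..<n} (\<lambda>_. M)) \<le> \<eta>" if n: "n \<ge> N" for n
  proof -
    let ?P = "PiM {..<n} (\<lambda>_. M)"
    interpret P: prob_space ?P by (rule prob_space_sample)
    have n1: "n \<ge> 1" using n by (simp add: N_def)
    have i1: "integrable ?P (\<lambda>x. (\<Sum>i<n. \<bar>x i - s (x i)\<bar>) / n)"
      using intd by (intro integrable_divide_zero Bochner_Integration.integrable_sum)
        (simp add: integrable_PiM_component[of "\<lambda>t. \<bar>t - s t\<bar>"])
    have i2: "integrable ?P (\<lambda>x. \<Sum>a\<in>A. \<bar>a\<bar> * \<bar>(\<Sum>i<n. h a (x i)) / n\<bar>)"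
      by (intro Bochner_Integration.integrable_sum integrable_mult_right
          expectation_abs_mean_centered(1) hm hb h0 n1)
    show "integrable ?P (U n)" unfolding U_def using i1 i2 by simp
    have "(\<integral>x. (\<Sum>i<n. \<bar>x i - s (x i)\<bar>) / n \<partial>?P) = (\<Sum>i<n. \<integral>x. \<bar>x i - s (x i)\<bar> \<partial>?P) / n"
      by (subst integral_divide_zero, subst Bochner_Integration.integral_sum)
         (use intd in \<open>auto simp: integrable_PiM_component[of "\<lambda>t. \<bar>t - s t\<bar>"]\<close>)
    also have "\<dots> = (\<integral>t. \<bar>t - s t\<bar> \<partial>M)"
      using n1 by (simp add: integral_PiM_component[of "\<lambda>t. \<bar>t - s t\<bar>"])
    finally have e1: "(\<integral>x. (\<Sum>i<n. \<bar>x i - s (x i)\<bar>) / n \<partial>?P) \<le> \<eta> / 4"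
      using i0 by (simp add: s_def)
    have "(\<integral>x. (\<Sum>a\<in>A. \<bar>a\<bar> * \<bar>(\<Sum>i<n. h a (x i)) / n\<bar>) \<partial>?P)
        = (\<Sum>a\<in>A. \<bar>a\<bar> * (\<integral>x. \<bar>(\<Sum>i<n. h a (x i)) / n\<bar> \<partial>?P))"
      by (subst Bochner_Integration.integral_sum)
         (auto simp del: abs_divide intro!: expectation_abs_mean_centered(1) hm hb h0 n1)
    also have "\<dots> \<le> (\<Sum>a\<in>A. \<bar>a\<bar> * (1 / sqrt n))"
      by (intro sum_mono mult_left_mono expectation_abs_mean_centered(2) hm hb h0 n1) auto
    also have "\<dots> = C / sqrt n" by (simp add: C_def sum_divide_distrib)
    also have "\<dots> \<le> \<eta> / 2"
    proof -
      have "(2 * C / \<eta>)\<^sup>2 \<le> n" using n unfolding N_def by linarith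
      then have "2 * C / \<eta> \<le> sqrt n" by (rule real_le_rsqrt)
      then show ?thesis using n1 \<eta> by (simp add: field_simps)
    qed
    finally have e2: "(\<integral>x. (\<Sum>a\<in>A. \<bar>a\<bar> * \<bar>(\<Sum>i<n. h a (x i)) / n\<bar>) \<partial>?P) \<le> \<eta> / 2" .
    have "(\<integral>x. U n x \<partial>?P) = (\<integral>x. (\<Sum>i<n. \<bar>x i - s (x i)\<bar>) / n \<partial>?P) + \<eta> / 4
        + (\<integral>x. (\<Sum>a\<in>A. \<bar>a\<bar> * \<bar>(\<Sum>i<n. h a (x i)) / n\<bar>) \<partial>?P)"
      unfolding U_def using i1 i2
      by (subst Bochner_Integration.integral_add, simp, simp, subst Bochner_Integration.integral_add)
        (auto simp: P.prob_space)
    then show "(\<integral>x. U n x \<partial>?P) \<le> \<eta>" using e1 e2 by linarith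
  qed
  have lip: "\<bar>(\<Sum>i<n. g (x i)) / n - (\<integral>t. g t \<partial>M)\<bar> \<le> U n x"
    if n: "n \<ge> N" and g: "1-lipschitz_on UNIV g" for n x g
  proof -
    have n1: "n \<ge> 1" using n by (simp add: N_def)
    have gl: "\<bar>g a - g b\<bar> \<le> \<bar>a - b\<bar>" for a b
      using lipschitz_onD[OF g, of a b] by (simp add: dist_real_def)
    have [measurable]: "g \<in> borel_measurable borel"
      using lipschitz_on_continuous_on[OF g] by (rule borel_measurable_continuous_onI)
    have intg: "integrable M g"
    proof (rule Bochner_Integration.integrable_bound[of _ "\<lambda>t. \<bar>g 0\<bar> + \<bar>t\<bar>"])
      show "AE t in M. norm (g t) \<le> norm (\<bar>g 0\<bar> + \<bar>t\<bar>)"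
      proof (rule AE_I2)
        fix t show "norm (g t) \<le> norm (\<bar>g 0\<bar> + \<bar>t\<bar>)" using gl[of t 0] by simp
      qed
      show "integrable M (\<lambda>t. \<bar>g 0\<bar> + \<bar>t\<bar>)" using int by simp
    qed measurable
    have intd': "integrable M (\<lambda>t. g t - g (s t))"
      by (rule Bochner_Integration.integrable_bound[OF intd]) (use gl in auto)
    have intgs: "integrable M (\<lambda>t. g (s t))"
      using Bochner_Integration.integrable_diff[OF intg intd'] by simp
    \<comment> \<open>This is the expectation of \<open>g \<circ> s\<close>. Subtracting
      \<open>g 0\<close> from each value makes the Lipschitz condition bound the coefficients,
      \<open>\<bar>g a - g 0\<bar> \<le> \<bar>a\<bar>\<close>.\<close>
    define c where "c = g 0 + (\<Sum>a\<in>A. (g a - g 0) * prob {t. s t = a})"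
    have gs: "g (s t) = c + (\<Sum>a\<in>A. (g a - g 0) * h a t)" for t
    proof -
      have "(\<Sum>a\<in>A. (g a - g 0) * indicator {t. s t = a} t) = (\<Sum>a\<in>A. if a = s t then g a - g 0 else 0)"
        by (intro sum.cong) auto
      also have "\<dots> = g (s t) - g 0" using finA by (simp add: A_def)
      finally show ?thesis
        by (simp add: c_def h_def right_diff_distrib sum_subtractf)
    qed
    have inth: "integrable M (\<lambda>t. (g a - g 0) * h a t)" for a
      by (intro integrable_mult_right integrable_const_bound[of "h a" 1]) (auto simp: hb)
    have "(\<integral>t. g (s t) \<partial>M) = (\<integral>t. c + (\<Sum>a\<in>A. (g a - g 0) * h a t) \<partial>M)"
      using gs by simp
    also have "\<dots> = c + (\<Sum>a\<in>A. (g a - g 0) * (\<integral>t. h a t \<partial>M))"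
      using inth prob_space by (subst Bochner_Integration.integral_add)
        (auto intro!: Bochner_Integration.integrable_sum simp: Bochner_Integration.integral_sum)
    finally have Egs: "(\<integral>t. g (s t) \<partial>M) = c" by (simp add: h0)
    have avg: "(\<Sum>i<n. g (s (x i))) / n = c + (\<Sum>a\<in>A. (g a - g 0) * ((\<Sum>i<n. h a (x i)) / n))"
    proof -
      have "(\<Sum>i<n. g (s (x i))) = n * c + (\<Sum>a\<in>A. (g a - g 0) * (\<Sum>i<n. h a (x i)))"
        unfolding gs sum.distrib sum_distrib_left by (subst sum.swap) simp
      then show ?thesis using n1 by (simp add: add_divide_distrib sum_divide_distrib[of _ A])
    qed
    have "(\<Sum>i<n. g (x i)) / n - (\<integral>t. g t \<partial>M) = (\<Sum>i<n. g (x i) - g (s (x i))) / n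
        + (\<Sum>a\<in>A. (g a - g 0) * ((\<Sum>i<n. h a (x i)) / n)) - (\<integral>t. g t - g (s t) \<partial>M)"
      using avg Egs intg intgs
      by (simp add: sum_subtractf diff_divide_distrib)
    moreover have "\<bar>(\<Sum>i<n. g (x i) - g (s (x i))) / n\<bar> \<le> (\<Sum>i<n. \<bar>x i - s (x i)\<bar>) / n"
      unfolding abs_divide abs_of_nat using gl
      by (intro divide_right_mono order_trans[OF sum_abs] sum_mono) auto
    moreover have "\<bar>\<integral>t. g t - g (s t) \<partial>M\<bar> \<le> \<eta> / 4"
    proof -
      have "\<bar>\<integral>t. g t - g (s t) \<partial>M\<bar> \<le> (\<integral>t. \<bar>g t - g (s t)\<bar> \<partial>M)" by (rule integral_abs_bound)
      also have "\<dots> \<le> (\<integral>t. \<bar>t - s t\<bar> \<partial>M)" using intd intd' gl by (intro integral_mono) auto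
      finally show ?thesis using i0 by (simp add: s_def)
    qed
    moreover have "\<bar>\<Sum>a\<in>A. (g a - g 0) * ((\<Sum>i<n. h a (x i)) / n)\<bar>
        \<le> (\<Sum>a\<in>A. \<bar>a\<bar> * \<bar>(\<Sum>i<n. h a (x i)) / n\<bar>)"
    proof (intro order_trans[OF sum_abs] sum_mono)
      fix a
      show "\<bar>(g a - g 0) * ((\<Sum>i<n. h a (x i)) / n)\<bar> \<le> \<bar>a\<bar> * \<bar>(\<Sum>i<n. h a (x i)) / n\<bar>"
        unfolding abs_mult using gl[of a 0] by (intro mult_right_mono) auto
    qed
    ultimately show ?thesis unfolding U_def by linarith
  qed
  show thesis by (rule that[of N U]) (auto simp: N_def int_U E_U lip)
qed

section \<open>Distance to the nearest facility\<close>

definition nearest_dist :: "nat \<Rightarrow> (nat \<Rightarrow> real) \<Rightarrow> real \<Rightarrow> real" where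
  "nearest_dist k z t = Min ((\<lambda>j. \<bar>t - z j\<bar>) ` {..<k})"

lemma SC_eq: "SC n k x z = (\<Sum>i<n. nearest_dist k z (x i)) / n"
  by (simp add: SC_def nearest_dist_def)

lemma nearest_dist_le: "j < k \<Longrightarrow> nearest_dist k z t \<le> \<bar>t - z j\<bar>"
  unfolding nearest_dist_def by (intro Min_le) auto

lemma nearest_dist_attained:
  assumes "k \<ge> 1"
  obtains j where "j < k" "nearest_dist k z t = \<bar>t - z j\<bar>"
proof -
  have "nearest_dist k z t \<in> (\<lambda>j. \<bar>t - z j\<bar>) ` {..<k}"
    unfolding nearest_dist_def using assms by (intro Min_in) (auto simp: lessThan_empty_iff)
  then show thesis using that by auto
qed

lemma nearest_dist_nonneg: "k \<ge> 1 \<Longrightarrow> 0 \<le> nearest_dist k z t"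
  by (metis nearest_dist_attained abs_ge_zero)

text \<open>The facility nearest to \<open>t'\<close> on the right is a competitor on the left. This
  one form covers moving the point, moving the facilities and, with \<open>e = 0\<close>, projecting
  them.\<close>

lemma nearest_dist_perturb:
  assumes "k \<ge> 1" and "\<And>j. j < k \<Longrightarrow> \<bar>t - z j\<bar> \<le> \<bar>t' - z' j\<bar> + e"
  shows "nearest_dist k z t \<le> nearest_dist k z' t' + e"
proof -
  obtain j where "j < k" "nearest_dist k z' t' = \<bar>t' - z' j\<bar>"
    using nearest_dist_attained assms(1) by blast
  then show ?thesis using nearest_dist_le[of j k z t] assms(2)[of j] by linarith
qed

lemma nearest_dist_lipschitz:
  assumes "k \<ge> 1"
  shows "1-lipschitz_on UNIV (nearest_dist k z)"
proof (rule lipschitz_onI)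
  fix s t :: real
  have "nearest_dist k z s \<le> nearest_dist k z t + \<bar>s - t\<bar>" "nearest_dist k z t \<le> nearest_dist k z s + \<bar>s - t\<bar>"
    using assms by (auto intro!: nearest_dist_perturb)
  then show "dist (nearest_dist k z s) (nearest_dist k z t) \<le> 1 * dist s t"
    by (simp add: dist_real_def abs_le_iff)
qed simp

lemma measurable_nearest_dist [measurable]: "nearest_dist k z \<in> borel_measurable borel"
  unfolding nearest_dist_def by measurable

section \<open>Order statistics and deviation of sample percentiles\<close>

text \<open>For a downward closed \<open>P\<close>, the positions of the sorted list that satisfy
  \<open>P\<close> form an initial segment, whose length sorting does not change. This turns
  statements about order statistics into counts.\<close>

lemma sort_nth_iff_length_filter:
  fixes xs :: "'a::linorder list"
  assumes m: "m < length xs" and down: "\<And>u w. u \<le> w \<Longrightarrow> P w \<Longrightarrow> P u"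
  shows "P (sort xs ! m) \<longleftrightarrow> m < length (filter P xs)"
proof -
  let ?I = "{i. i < length xs \<and> P (sort xs ! i)}"
  have "length (filter P xs) = length (filter P (sort xs))"
    by (metis mset_filter mset_sort size_mset)
  then have len: "length (filter P xs) = card ?I"
    by (simp add: length_filter_conv_card)
  have mono: "sort xs ! i \<le> sort xs ! j" if "i \<le> j" "j < length xs" for i j
    using that by (intro sorted_nth_mono) auto
  show ?thesis
  proof
    assume "P (sort xs ! m)"
    then have "{..m} \<subseteq> ?I" using m mono down by force
    then have "card {..m} \<le> card ?I" by (intro card_mono) auto
    then show "m < length (filter P xs)" by (simp add: len)
  next
    assume *: "m < length (filter P xs)"
    show "P (sort xs ! m)"
    proof (rule ccontr)
      assume neg: "\<not> P (sort xs ! m)"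
      have "?I \<subseteq> {..<m}"
      proof
        fix i assume "i \<in> ?I"
        then show "i \<in> {..<m}" using neg mono[of m i] down by (cases "i < m") auto
      qed
      then have "card ?I \<le> card {..<m}" by (intro card_mono) auto
      then show False using * by (simp add: len)
    qed
  qed
qed

lemma percentile_index_less:
  fixes v :: real
  assumes "v \<le> 1" and "n \<ge> 1"
  shows "nat \<lfloor>real (n - 1) * v\<rfloor> < n"
proof -
  have "real (n - 1) * v \<le> real (n - 1) * 1" using assms by (intro mult_left_mono) auto
  then show ?thesis using assms by linarith
qed

lemma percentile_mech_iff_card:
  assumes "v j \<le> 1" and "n \<ge> 1" and down: "\<And>u w. u \<le> w \<Longrightarrow> P w \<Longrightarrow> P u"
  shows "P (percentile_mech v n x j) \<longleftrightarrow> nat \<lfloor>real (n - 1) * v j\<rfloor> < card {i. i < n \<and> P (x i)}"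
proof -
  define m where "m = nat \<lfloor>real (n - 1) * v j\<rfloor>"
  have "m < length (map x [0..<n])" using percentile_index_less assms by (simp add: m_def)
  then have "P (sort (map x [0..<n]) ! m) \<longleftrightarrow> m < length (filter P (map x [0..<n]))"
    by (rule sort_nth_iff_length_filter) (fact down)
  also have "length (filter P (map x [0..<n])) = card {i. i < n \<and> P (x i)}"
    by (auto simp: length_filter_conv_card intro!: arg_cong[where f=card])
  finally show ?thesis by (simp only: percentile_mech_def m_def)
qed

lemma percentile_mech_in_sample:
  assumes "v j \<le> 1" and "n \<ge> 1"
  shows "percentile_mech v n x j \<in> x ` {..<n}"
proof -
  have "percentile_mech v n x j \<in> set (sort (map x [0..<n]))"
    unfolding percentile_mech_def
    by (intro nth_mem, unfold length_sort length_map length_upt diff_zero)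
       (intro percentile_index_less assms)
  then show ?thesis by auto
qed

lemma card_less_percentile_mech:
  fixes v :: "nat \<Rightarrow> real"
  assumes "0 \<le> v j" "v j \<le> 1" and "n \<ge> 1"
  shows "card {i. i < n \<and> x i < percentile_mech v n x j} \<le> n * v j"
proof -
  \<comment> \<open>The counting criterion is applied to the property of lying strictly below the
    percentile, which the percentile itself fails.\<close>
  have "\<not> nat \<lfloor>real (n - 1) * v j\<rfloor> < card {i. i < n \<and> x i < percentile_mech v n x j}"
    using percentile_mech_iff_card[of v j n "\<lambda>u. u < percentile_mech v n x j" x] assms by auto
  then have "card {i. i < n \<and> x i < percentile_mech v n x j} \<le> real (n - 1) * v j"
    using assms(1) zero_le_mult_iff[of "real (n - 1)" "v j"] by linarith
  also have "\<dots> \<le> n * v j" using assms(1) by (intro mult_right_mono) auto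
  finally show ?thesis .
qed

text \<open>The percentile is one of the points not above itself, so its index is below the count.
  The loss of 1 is the price of replacing \<open>n - 1\<close> by \<open>n\<close>, as
  \<open>v j \<le> 1\<close>.\<close>

lemma card_le_percentile_mech:
  fixes v :: "nat \<Rightarrow> real"
  assumes "0 \<le> v j" "v j \<le> 1" and "n \<ge> 1"
  shows "n * v j - 1 \<le> card {i. i < n \<and> x i \<le> percentile_mech v n x j}"
proof -
  have "nat \<lfloor>real (n - 1) * v j\<rfloor> < card {i. i < n \<and> x i \<le> percentile_mech v n x j}"
    using percentile_mech_iff_card[of v j n "\<lambda>u. u \<le> percentile_mech v n x j" x] assms by auto
  then have "real (n - 1) * v j \<le> card {i. i < n \<and> x i \<le> percentile_mech v n x j}"
    by linarith
  moreover have "n * v j - 1 \<le> real (n - 1) * v j"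
    using assms by (simp add: algebra_simps of_nat_diff)
  ultimately show ?thesis by linarith
qed

text \<open>Test with the function that vanishes up to \<open>c\<close>, then rises with slope 1 and
  is cut off at height \<open>q - c\<close>, where \<open>q\<close> is the percentile. It has full
  height on at least a fraction \<open>1 - v j\<close> of the sample, whereas its expectation is at
  most \<open>q - c\<close> times the mass beyond \<open>c\<close>. The test function depends on the
  sample through \<open>q\<close>, which is why \<open>U\<close> has to bound all 1-Lipschitz
  functions at once.\<close>

lemma (in real_distribution) percentile_mech_upper:
  fixes v :: "nat \<Rightarrow> real"
  assumes v: "0 \<le> v j" "v j \<le> 1" and n: "n \<ge> 1" and c: "c < percentile_mech v n x j"
    and U: "\<And>g. 1-lipschitz_on UNIV g \<Longrightarrow> \<bar>(\<Sum>i<n. g (x i)) / n - (\<integral>t. g t \<partial>M)\<bar> \<le> U"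
  shows "(percentile_mech v n x j - c) * (cdf M c - v j) \<le> U"
proof -
  define q where "q = percentile_mech v n x j"
  have cq: "c < q" using c by (simp add: q_def)
  define g where "g t = max 0 (min (t - c) (q - c))" for t
  have g: "1-lipschitz_on UNIV g"
    by (rule lipschitz_onI) (auto simp: g_def dist_real_def)
  have "(q - c) * (n * (1 - v j)) \<le> (q - c) * card {i. i < n \<and> \<not> x i < q}"
  proof (intro mult_left_mono)
    have "{..<n} = {i. i < n \<and> x i < q} \<union> {i. i < n \<and> \<not> x i < q}" by auto
    then have "card {i. i < n \<and> x i < q} + card {i. i < n \<and> \<not> x i < q} = card {..<n}"
      by (subst card_Un_disjoint[symmetric]) auto
    then show "n * (1 - v j) \<le> card {i. i < n \<and> \<not> x i < q}"
      using card_less_percentile_mech[of v j n x] v n by (simp add: q_def algebra_simps)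
  qed (use cq in auto)
  also have "\<dots> = (\<Sum>i\<in>{i. i < n \<and> \<not> x i < q}. g (x i))"
    using cq by (simp add: g_def)
  also have "\<dots> \<le> (\<Sum>i<n. g (x i))"
    by (intro sum_mono2) (auto simp: g_def)
  finally have 1: "(q - c) * (1 - v j) \<le> (\<Sum>i<n. g (x i)) / n"
    using n by (simp add: field_simps)
  have "(\<integral>t. g t \<partial>M) \<le> (\<integral>t. (q - c) * indicator {c<..} t \<partial>M)"
    using cq lipschitz_on_continuous_on[OF g, THEN borel_measurable_continuous_onI]
    by (intro integral_mono integrable_const_bound[of g "q - c"]) (auto simp: g_def less_top[symmetric] intro!: integrable_real_indicator split: split_indicator)
  also have "\<dots> = (q - c) * (1 - cdf M c)"
    using prob_compl[of "{..c}"] by (simp add: cdf_def Compl_eq_Diff_UNIV[symmetric])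
  finally have 2: "(\<integral>t. g t \<partial>M) \<le> (q - c) * (1 - cdf M c)" .
  have "(q - c) * (cdf M c - v j) \<le> (\<Sum>i<n. g (x i)) / n - (\<integral>t. g t \<partial>M)"
    using 1 2 by (simp add: algebra_simps)
  then show ?thesis using U[OF g] unfolding q_def by linarith
qed

text \<open>Mirror image of the upper estimate; the term \<open>1 / n\<close> comes from the loss of
  1 in the count of points not above the percentile.\<close>

lemma (in real_distribution) percentile_mech_lower:
  fixes v :: "nat \<Rightarrow> real"
  assumes v: "0 \<le> v j" "v j \<le> 1" and n: "n \<ge> 1" and c: "percentile_mech v n x j < c"
    and U: "\<And>g. 1-lipschitz_on UNIV g \<Longrightarrow> \<bar>(\<Sum>i<n. g (x i)) / n - (\<integral>t. g t \<partial>M)\<bar> \<le> U"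
  shows "(c - percentile_mech v n x j) * (v j - 1 / n - cdf M c) \<le> U"
proof -
  define q where "q = percentile_mech v n x j"
  have cq: "q < c" using c by (simp add: q_def)
  define g where "g t = max 0 (min (c - t) (c - q))" for t
  have g: "1-lipschitz_on UNIV g"
    by (rule lipschitz_onI) (auto simp: g_def dist_real_def)
  have "(c - q) * (n * v j - 1) \<le> (c - q) * card {i. i < n \<and> x i \<le> q}"
    using card_le_percentile_mech[of v j n x] v n cq by (intro mult_left_mono) (auto simp: q_def)
  also have "\<dots> = (\<Sum>i\<in>{i. i < n \<and> x i \<le> q}. g (x i))"
    using cq by (simp add: g_def)
  also have "\<dots> \<le> (\<Sum>i<n. g (x i))"
    by (intro sum_mono2) (auto simp: g_def)
  finally have "(c - q) * (n * v j - 1) / n \<le> (\<Sum>i<n. g (x i)) / n"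
    by (rule divide_right_mono) simp
  moreover have "(c - q) * (n * v j - 1) / n = (c - q) * (v j - 1 / n)"
    using n by (simp add: field_simps)
  ultimately have 1: "(c - q) * (v j - 1 / n) \<le> (\<Sum>i<n. g (x i)) / n" by simp
  have "(\<integral>t. g t \<partial>M) \<le> (\<integral>t. (c - q) * indicator {..c} t \<partial>M)"
    using cq lipschitz_on_continuous_on[OF g, THEN borel_measurable_continuous_onI]
    by (intro integral_mono integrable_const_bound[of g "c - q"]) (auto simp: g_def less_top[symmetric] intro!: integrable_real_indicator split: split_indicator)
  also have "\<dots> = (c - q) * cdf M c"
    by (simp add: cdf_def)
  finally have 2: "(\<integral>t. g t \<partial>M) \<le> (c - q) * cdf M c" .
  have "(c - q) * (v j - 1 / n - cdf M c) \<le> (\<Sum>i<n. g (x i)) / n - (\<integral>t. g t \<partial>M)"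
    using 1 2 by (simp add: algebra_simps)
  then show ?thesis using U[OF g] unfolding q_def by linarith
qed

section \<open>Support, growth of the c.d.f. and closeness of percentiles\<close>

lemma Compl_msupport: "- msupport M = \<Union>{B. open B \<and> emeasure M B = 0}" if "sets M = sets borel"
proof (intro equalityI subsetI)
  fix x assume "x \<in> - msupport M"
  then obtain e where "e > 0" "emeasure M (ball x e) = 0" by (auto simp: msupport_def)
  then show "x \<in> \<Union>{B. open B \<and> emeasure M B = 0}"
    by (intro UnionI[of "ball x e"]) auto
next
  fix x assume "x \<in> \<Union>{B. open B \<and> emeasure M B = 0}"
  then obtain B where B: "open B" "emeasure M B = 0" "x \<in> B" by auto
  then obtain e where e: "e > 0" "ball x e \<subseteq> B" by (auto simp: open_contains_ball)
  have "emeasure M (ball x e) \<le> emeasure M B"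
    using e B that by (intro emeasure_mono) auto
  then show "x \<in> - msupport M" using B e by (auto simp: msupport_def)
qed

lemma closed_msupport: "sets M = sets borel \<Longrightarrow> closed (msupport M)"
  unfolding closed_def by (subst Compl_msupport) auto

text \<open>The complement of the support is a union of open null sets; by Lindelof countably many
  of them suffice.\<close>

lemma AE_in_msupport:
  assumes M: "sets M = sets borel"
  shows "AE t in M. t \<in> msupport M"
proof -
  obtain \<F> where F: "\<F> \<subseteq> {B. open B \<and> emeasure M B = 0}" "countable \<F>" "\<Union>\<F> = - msupport M"
    using Lindelof[of "{B. open B \<and> emeasure M B = 0}"] Compl_msupport[OF M] by auto
  have "(\<Union>B\<in>\<F>. B) \<in> null_sets M"
    using F M by (intro null_sets_UN') (auto simp: null_sets_def)
  then have "AE t in M. t \<notin> - msupport M" using F(3) by (intro AE_not_in) simp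
  then show ?thesis by simp
qed

lemma (in real_distribution) cdf_mono: "s \<le> t \<Longrightarrow> cdf M s \<le> cdf M t"
  unfolding cdf_def by (intro finite_measure_mono) auto

text \<open>The midpoint lies in the support, so the ball around it that fits between
  \<open>s\<close> and \<open>t\<close> has positive mass.\<close>

lemma (in real_distribution) cdf_strict_mono_msupport:
  assumes S: "is_interval (msupport M)" "s \<in> msupport M" "t \<in> msupport M" and st: "s < t"
  shows "cdf M s < cdf M t"
proof -
  define m where "m = (s + t) / 2"
  have "m \<in> msupport M" by (rule mem_is_interval_1_I[of _ s t]) (use S st in \<open>auto simp: m_def\<close>)
  moreover have "(t - s) / 2 > 0" using st by simp
  ultimately have "emeasure M (ball m ((t - s) / 2)) > 0" unfolding msupport_def by blast
  then have "0 < measure M (ball m ((t - s) / 2))" by (simp add: emeasure_eq_measure)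
  also have "\<dots> \<le> measure M {s<..t}"
  proof (intro finite_measure_mono subsetI)
    fix u assume "u \<in> ball m ((t - s) / 2)"
    then have "\<bar>m - u\<bar> < (t - s) / 2" by (simp add: dist_real_def)
    then show "u \<in> {s<..t}" unfolding m_def greaterThanAtMost_iff by argo
  qed simp
  also have "\<dots> = cdf M t - cdf M s"
  proof -
    have "{s<..t} = {..t} - {..s}" by auto
    then show ?thesis using st by (simp add: cdf_def finite_measure_Diff)
  qed
  finally show ?thesis by simp
qed

text \<open>The c.d.f. must grow from \<open>p\<close> to \<open>p + \<epsilon>\<close> only if the
  support reaches further. The bounds are therefore conditional on a support point \<open>q\<close>
  beyond, which will be the sample percentile.\<close>

lemma (in real_distribution) cdf_gap:
  assumes S: "is_interval (msupport M)" "p \<in> msupport M" and e: "\<epsilon> > 0"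
  obtains \<delta> where "\<delta> > 0"
    and "\<And>q. q \<in> msupport M \<Longrightarrow> q > p + \<epsilon> \<Longrightarrow> cdf M (p + \<epsilon>) \<ge> cdf M p + \<delta>"
    and "\<And>q. q \<in> msupport M \<Longrightarrow> q < p - \<epsilon> \<Longrightarrow> cdf M (p - \<epsilon>) \<le> cdf M p - \<delta>"
proof -
  have up: "cdf M p < cdf M (p + \<epsilon>)" if "q \<in> msupport M" "q > p + \<epsilon>" for q
  proof -
    have "p + \<epsilon> \<in> msupport M" by (rule mem_is_interval_1_I[of _ p q "p + \<epsilon>"]) (use S that e in auto)
    then show ?thesis using S e by (intro cdf_strict_mono_msupport) auto
  qed
  have down: "cdf M (p - \<epsilon>) < cdf M p" if "q \<in> msupport M" "q < p - \<epsilon>" for q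
  proof -
    have "p - \<epsilon> \<in> msupport M" by (rule mem_is_interval_1_I[of _ q p "p - \<epsilon>"]) (use S that e in auto)
    then show ?thesis using S e by (intro cdf_strict_mono_msupport) auto
  qed
  \<comment> \<open>The default 1 only keeps the minimum positive: where it applies,
    \<open>up\<close> or \<open>down\<close> excludes any such \<open>q\<close>.\<close>
  define d1 where "d1 = (if cdf M p < cdf M (p + \<epsilon>) then cdf M (p + \<epsilon>) - cdf M p else 1)"
  define d2 where "d2 = (if cdf M (p - \<epsilon>) < cdf M p then cdf M p - cdf M (p - \<epsilon>) else 1)"
  show thesis
  proof (rule that[of "min d1 d2"])
    show "0 < min d1 d2" by (simp add: d1_def d2_def)
    show "cdf M (p + \<epsilon>) \<ge> cdf M p + min d1 d2" if "q \<in> msupport M" "q > p + \<epsilon>" for q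
      using up[OF that] by (simp add: d1_def)
    show "cdf M (p - \<epsilon>) \<le> cdf M p - min d1 d2" if "q \<in> msupport M" "q < p - \<epsilon>" for q
      using down[OF that] by (simp add: d2_def)
  qed
qed

text \<open>The one-sided estimates are used at \<open>c = p + \<epsilon>\<close> and
  \<open>c = p - \<epsilon>\<close>, where the c.d.f. differs from \<open>v j\<close> by at least
  \<open>\<delta>\<close>. Below \<open>p\<close>, the condition \<open>n \<ge> 2 / \<delta>\<close>
  lets \<open>1 / n\<close> consume at most half of \<open>\<delta>\<close>, hence the factor
  2.\<close>

lemma (in real_distribution) percentile_mech_close:
  fixes U \<delta> \<epsilon> p :: real and v :: "nat \<Rightarrow> real"
  assumes \<delta>: "\<delta> > 0" and \<epsilon>: "\<epsilon> > 0" and v: "v j = cdf M p" and n: "n \<ge> 1" "n \<ge> 2 / \<delta>"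
    and up: "percentile_mech v n x j > p + \<epsilon> \<Longrightarrow> cdf M (p + \<epsilon>) \<ge> cdf M p + \<delta>"
    and down: "percentile_mech v n x j < p - \<epsilon> \<Longrightarrow> cdf M (p - \<epsilon>) \<le> cdf M p - \<delta>"
    and U: "\<And>g. 1-lipschitz_on UNIV g \<Longrightarrow> \<bar>(\<Sum>i<n. g (x i)) / n - (\<integral>t. g t \<partial>M)\<bar> \<le> U"
  shows "\<bar>percentile_mech v n x j - p\<bar> \<le> \<epsilon> + 2 * U / \<delta>"
proof -
  define q where "q = percentile_mech v n x j"
  have v01: "0 \<le> v j" "v j \<le> 1" by (auto simp: v cdf_def)
  \<comment> \<open>Testing with the zero function shows that \<open>U\<close> is
    nonnegative.\<close>
  have "1-lipschitz_on UNIV (\<lambda>_::real. 0::real)" by (rule lipschitz_onI) auto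
  from U[OF this] have U0: "U \<ge> 0" by simp
  consider "q > p + \<epsilon>" | "q < p - \<epsilon>" | "\<bar>q - p\<bar> \<le> \<epsilon>" by linarith
  then show ?thesis
  proof cases
    case 1
    have "(q - (p + \<epsilon>)) * \<delta> \<le> (q - (p + \<epsilon>)) * (cdf M (p + \<epsilon>) - v j)"
      using up 1 by (intro mult_left_mono) (auto simp: v q_def)
    also have "\<dots> \<le> U"
      using percentile_mech_upper[of v j n "p + \<epsilon>" x U] v01 n 1 U by (simp add: q_def)
    finally have "q - (p + \<epsilon>) \<le> U / \<delta>" using \<delta> by (simp add: pos_le_divide_eq)
    moreover have "U / \<delta> \<ge> 0" using U0 \<delta> by simp
    ultimately show ?thesis using 1 \<epsilon> unfolding q_def[symmetric] by simp
  next
    case 2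
    have "1 / n \<le> \<delta> / 2" using n \<delta> by (simp add: field_simps)
    then have "((p - \<epsilon>) - q) * (\<delta> / 2) \<le> ((p - \<epsilon>) - q) * (v j - 1 / n - cdf M (p - \<epsilon>))"
      using down 2 unfolding v q_def[symmetric] by (intro mult_left_mono) auto
    also have "\<dots> \<le> U"
      using percentile_mech_lower[of v j n x "p - \<epsilon>" U] v01 n 2 U by (simp add: q_def)
    finally have "(p - \<epsilon>) - q \<le> U / (\<delta> / 2)" using \<delta> by (subst pos_le_divide_eq) auto
    moreover have "U / \<delta> \<ge> 0" using U0 \<delta> by simp
    ultimately show ?thesis using 2 \<epsilon> unfolding q_def[symmetric] by (simp add: mult.commute)
  next
    case 3
    moreover have "U / \<delta> \<ge> 0" using U0 \<delta> by simp
    ultimately show ?thesis unfolding q_def[symmetric] by simp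
  qed
qed

text \<open>No support point lies strictly between \<open>p\<close> and its projection, and the
  endpoints are null, so the two half-lines agree almost everywhere.\<close>

lemma (in real_distribution) cdf_closest_point_msupport:
  assumes nonempty: "msupport M \<noteq> {}" and atomless: "\<And>c. AE t in M. t \<noteq> c"
  shows "cdf M (closest_point (msupport M) p) = cdf M p"
  unfolding cdf_def
proof (rule measure_eq_AE)
  let ?c = "closest_point (msupport M) p"
  have le: "\<bar>p - ?c\<bar> \<le> \<bar>p - t\<bar>" if "t \<in> msupport M" for t
    using closest_point_le[OF closed_msupport that, of p] by (simp add: dist_real_def)
  show "AE t in M. t \<in> {..?c} \<longleftrightarrow> t \<in> {..p}"
    using AE_in_msupport[OF events_eq_borel] atomless[of ?c] atomless[of p]
  proof eventually_elim
    case (elim t)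
    then show ?case using le[of t] by auto
  qed
qed auto

lemma (in real_distribution) msupport_nonempty: "msupport M \<noteq> {}"
proof
  assume "msupport M = {}"
  then have "AE t in M. False" using AE_in_msupport[OF events_eq_borel] by simp
  then show False by simp
qed

section \<open>Wasserstein distance and optimal placements\<close>

text \<open>Under any coupling the second coordinate is almost surely one of the \<open>y j\<close>,
  so the first is at least its nearest distance away.\<close>

lemma (in real_distribution) nn_integral_nearest_dist_le_W1:
  assumes k: "k \<ge> 1" and sets_L: "sets L = sets borel" and supp: "msupport L = y ` {..<k}"
  shows "(\<integral>\<^sup>+t. ennreal (nearest_dist k y t) \<partial>M) \<le> W1 M L"
  unfolding W1_def
proof (rule INF_greatest)
  fix \<pi> assume "\<pi> \<in> couplings M L"
  then have [measurable_cong]: "sets \<pi> = sets (borel \<Otimes>\<^sub>M borel)"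
    and fst: "distr \<pi> borel fst = M" and snd: "distr \<pi> borel snd = L"
    by (auto simp: couplings_def)
  have "AE t in distr \<pi> borel snd. t \<in> msupport L"
    unfolding snd using AE_in_msupport[OF sets_L] .
  then have supp_snd: "AE p in \<pi>. snd p \<in> y ` {..<k}"
    unfolding supp by (rule AE_distrD[rotated]) simp
  have "(\<integral>\<^sup>+t. ennreal (nearest_dist k y t) \<partial>M) = (\<integral>\<^sup>+p. ennreal (nearest_dist k y (fst p)) \<partial>\<pi>)"
    by (subst fst[symmetric], subst nn_integral_distr) auto
  also have "\<dots> \<le> (\<integral>\<^sup>+p. ennreal \<bar>fst p - snd p\<bar> \<partial>\<pi>)"
    by (intro nn_integral_mono_AE) (use supp_snd in \<open>eventually_elim, auto intro!: ennreal_leI nearest_dist_le\<close>)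
  finally show "(\<integral>\<^sup>+t. ennreal (nearest_dist k y t) \<partial>M) \<le> (\<integral>\<^sup>+p. ennreal \<bar>fst p - snd p\<bar> \<partial>\<pi>)" .
qed

text \<open>\<open>L'\<close> is the image of \<open>M\<close> under a nearest-point map
  \<open>T\<close>, and the law of \<open>(t, T t)\<close> is a coupling with exactly this
  cost.\<close>

lemma (in real_distribution) W1_le_nn_integral_nearest_dist:
  assumes k: "k \<ge> 1"
  obtains L' where "L' \<in> Pk k" "W1 M L' \<le> (\<integral>\<^sup>+t. ennreal (nearest_dist k z t) \<partial>M)"
proof -
  \<comment> \<open>Ties go to the least index, which makes the choice measurable. Weights are taken
    over the cells of \<open>J\<close>, so repeated points \<open>z j\<close> are not counted
    twice.\<close>
  define J where "J t = (LEAST j. j < k \<and> nearest_dist k z t = \<bar>t - z j\<bar>)" for t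
  have J: "J t < k" "nearest_dist k z t = \<bar>t - z (J t)\<bar>" for t
  proof -
    obtain j where "j < k \<and> nearest_dist k z t = \<bar>t - z j\<bar>" using nearest_dist_attained[OF k] by metis
    from LeastI[of "\<lambda>j. j < k \<and> nearest_dist k z t = \<bar>t - z j\<bar>", OF this]
    show "J t < k" "nearest_dist k z t = \<bar>t - z (J t)\<bar>" by (auto simp: J_def)
  qed
  have [measurable]: "J \<in> borel \<rightarrow>\<^sub>M count_space UNIV" unfolding J_def by measurable
  define T where "T t = z (J t)" for t
  have T [measurable]: "T \<in> borel_measurable borel" unfolding T_def by measurable
  define L' where "L' = distr M borel T"
  define \<nu> where "\<nu> j = prob {t. J t = j}" for j
  have L'_eq: "emeasure L' A = (\<Sum>j<k. ennreal (\<nu> j) * indicator A (z j))" if A [measurable]: "A \<in> sets borel" for A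
  proof -
    have "emeasure L' A = (\<integral>\<^sup>+t. indicator A (T t) \<partial>M)"
      unfolding L'_def by (subst nn_integral_indicator[symmetric], simp, subst nn_integral_distr) auto
    also have "\<dots> = (\<integral>\<^sup>+t. (\<Sum>j<k. indicator {t. J t = j} t * indicator A (z j)) \<partial>M)"
    proof (rule nn_integral_cong)
      fix t
      have "(\<Sum>j<k. indicator {t. J t = j} t * indicator A (z j))
          = (\<Sum>j<k. if j = J t then indicator A (z j) else 0 :: ennreal)"
        by (intro sum.cong) auto
      then show "indicator A (T t) = (\<Sum>j<k. indicator {t. J t = j} t * indicator A (z j) :: ennreal)"
        using J(1)[of t] by (simp add: T_def)
    qed
    also have "\<dots> = (\<Sum>j<k. emeasure M {t. J t = j} * indicator A (z j))"
      by (subst nn_integral_sum, simp) (auto intro!: sum.cong simp: nn_integral_multc)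
    finally show ?thesis by (simp add: \<nu>_def emeasure_eq_measure)
  qed
  have "prob_space L'" unfolding L'_def by (intro prob_space_distr) simp
  then have "emeasure L' UNIV = 1" using prob_space.emeasure_space_1[of L'] by (simp add: L'_def)
  then have "ennreal (\<Sum>j<k. \<nu> j) = 1" using L'_eq[of UNIV] by (simp add: \<nu>_def)
  then have "(\<Sum>j<k. \<nu> j) = 1" by (simp add: ennreal_eq_1)
  then have Pk: "L' \<in> Pk k"
    unfolding Pk_def mem_Collect_eq using L'_eq
    by (intro conjI exI[of _ \<nu>] exI[of _ z]) (auto simp: L'_def \<nu>_def)
  define \<pi> where "\<pi> = distr M (borel \<Otimes>\<^sub>M borel) (\<lambda>t. (t, T t))"
  have "\<pi> \<in> couplings M L'"
    unfolding couplings_def \<pi>_def L'_def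
    by (auto intro!: prob_space_distr simp: distr_distr comp_def distr_id2)
  then have "W1 M L' \<le> (\<integral>\<^sup>+p. ennreal \<bar>fst p - snd p\<bar> \<partial>\<pi>)"
    unfolding W1_def by (rule INF_lower)
  also have "\<dots> = (\<integral>\<^sup>+t. ennreal (nearest_dist k z t) \<partial>M)"
    unfolding \<pi>_def by (subst nn_integral_distr) (auto simp: J(2) T_def)
  finally show thesis using Pk that by blast
qed

lemma (in real_distribution) integrable_nearest_dist:
  assumes "integrable M (\<lambda>t. t)" and k: "k \<ge> 1"
  shows "integrable M (nearest_dist k z)"
proof (rule Bochner_Integration.integrable_bound[of _ "\<lambda>t. \<bar>t\<bar> + \<bar>z 0\<bar>"])
  show "AE t in M. norm (nearest_dist k z t) \<le> norm (\<bar>t\<bar> + \<bar>z 0\<bar>)"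
  proof (rule AE_I2)
    fix t show "norm (nearest_dist k z t) \<le> norm (\<bar>t\<bar> + \<bar>z 0\<bar>)"
      using nearest_dist_le[of 0 k z t] nearest_dist_nonneg[OF k, of z t] k by simp
  qed
  show "integrable M (\<lambda>t. \<bar>t\<bar> + \<bar>z 0\<bar>)" using assms(1) by simp
qed simp

text \<open>Optimality of \<open>L\<close> links the two preceding bounds: the cost of
  \<open>y\<close> is at most \<open>W1 M L\<close>, hence at most \<open>W1 M L'\<close>, hence at
  most the cost of \<open>z\<close>.\<close>

lemma (in real_distribution) optimal_support_minimizes:
  assumes int: "integrable M (\<lambda>t. t)" and k: "k \<ge> 1" and L: "L \<in> Pk k"
    and opt: "\<forall>L' \<in> Pk k. W1 M L \<le> W1 M L'" and supp: "msupport L = y ` {..<k}"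
  shows "(\<integral>t. nearest_dist k y t \<partial>M) \<le> (\<integral>t. nearest_dist k z t \<partial>M)"
proof -
  obtain L' where L': "L' \<in> Pk k" "W1 M L' \<le> (\<integral>\<^sup>+t. ennreal (nearest_dist k z t) \<partial>M)"
    using W1_le_nn_integral_nearest_dist[OF k] by metis
  have "(\<integral>\<^sup>+t. ennreal (nearest_dist k y t) \<partial>M) \<le> W1 M L"
    using L supp by (intro nn_integral_nearest_dist_le_W1 k) (auto simp: Pk_def)
  also have "\<dots> \<le> W1 M L'" using opt L' by blast
  also note L'(2)
  finally have "ennreal (\<integral>t. nearest_dist k y t \<partial>M) \<le> ennreal (\<integral>t. nearest_dist k z t \<partial>M)"
    using nearest_dist_nonneg[OF k]
    by (simp add: nn_integral_eq_integral[OF integrable_nearest_dist[OF int k]])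
  moreover have "0 \<le> (\<integral>t. nearest_dist k z t \<partial>M)"
    using nearest_dist_nonneg[OF k] by (intro integral_nonneg_AE) auto
  ultimately show ?thesis by simp
qed

text \<open>A zero integral would concentrate \<open>M\<close> on the finitely many facilities.
  Positivity permits dividing by the limiting cost.\<close>

lemma (in real_distribution) integral_nearest_dist_pos:
  assumes "integrable M (\<lambda>t. t)" and k: "k \<ge> 1" and atomless: "\<And>c. AE t in M. t \<noteq> c"
  shows "0 < (\<integral>t. nearest_dist k z t \<partial>M)"
proof (rule ccontr)
  assume "\<not> 0 < (\<integral>t. nearest_dist k z t \<partial>M)"
  moreover have "0 \<le> (\<integral>t. nearest_dist k z t \<partial>M)"
    using nearest_dist_nonneg[OF k] by (intro integral_nonneg_AE) auto
  ultimately have "(\<integral>t. nearest_dist k z t \<partial>M) = 0" by linarith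
  then have "AE t in M. nearest_dist k z t = 0"
    using integral_nonneg_eq_0_iff_AE[OF integrable_nearest_dist[OF assms(1) k, of z]]
      nearest_dist_nonneg[OF k] by auto
  moreover have "AE t in M. \<forall>j\<in>{..<k}. t \<noteq> z j" using atomless by (intro AE_finite_allI) auto
  ultimately have "AE t in M. False"
  proof eventually_elim
    case (elim t)
    obtain j where "j < k" "nearest_dist k z t = \<bar>t - z j\<bar>" using nearest_dist_attained[OF k] by blast
    then show ?case using elim by auto
  qed
  then show False by simp
qed

section \<open>Bounds and measurability of the social costs\<close>

lemma SC_nonneg: "k \<ge> 1 \<Longrightarrow> 0 \<le> SC n k x z"
  unfolding SC_eq by (intro divide_nonneg_nonneg sum_nonneg nearest_dist_nonneg) auto

lemma SC_opt_le: "k \<ge> 1 \<Longrightarrow> SC_opt n k x \<le> SC n k x z"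
  unfolding SC_opt_def by (intro cINF_lower bdd_belowI2[of _ 0] SC_nonneg) auto

lemma SC_opt_ge: "(\<And>z. a \<le> SC n k x z) \<Longrightarrow> a \<le> SC_opt n k x"
  unfolding SC_opt_def by (intro cINF_greatest) auto

lemma SC_perturb:
  assumes "k \<ge> 1" "n \<ge> 1" and "\<And>j. j < k \<Longrightarrow> \<bar>z j - z' j\<bar> \<le> e"
  shows "SC n k x z \<le> SC n k x z' + e"
proof -
  have "(\<Sum>i<n. nearest_dist k z (x i)) \<le> (\<Sum>i<n. nearest_dist k z' (x i) + e)"
  proof (intro sum_mono nearest_dist_perturb assms(1))
    fix i j assume "j < k"
    then show "\<bar>x i - z j\<bar> \<le> \<bar>x i - z' j\<bar> + e" using assms(3)[of j] by linarith
  qed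
  then show ?thesis using assms(2) by (simp add: SC_eq sum.distrib field_simps)
qed

text \<open>Serves measurability: the infimum is reduced to a countable one, since rational
  placements approximate any placement. The extensional function space fixes the values outside
  \<open>{..<k}\<close> and so keeps the index set countable.\<close>

lemma SC_opt_eq_INF_rational:
  assumes k: "k \<ge> 1" and n: "n \<ge> 1"
  shows "SC_opt n k x = (INF z \<in> {..<k} \<rightarrow>\<^sub>E \<rat>. SC n k x z)"
proof (rule antisym)
  have bdd: "bdd_below (SC n k x ` A)" for A by (intro bdd_belowI2[of _ 0] SC_nonneg k)
  have ne: "({..<k} \<rightarrow>\<^sub>E (\<rat> :: real set)) \<noteq> {}" by (auto simp: PiE_eq_empty_iff intro: Rats_0)
  show "SC_opt n k x \<le> (INF z \<in> {..<k} \<rightarrow>\<^sub>E \<rat>. SC n k x z)"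
    using ne by (intro cINF_greatest SC_opt_le k)
  show "(INF z \<in> {..<k} \<rightarrow>\<^sub>E \<rat>. SC n k x z) \<le> SC_opt n k x"
  proof (rule SC_opt_ge, rule field_le_epsilon)
    fix z :: "nat \<Rightarrow> real" and e :: real assume "e > 0"
    then have "\<forall>j. \<exists>r\<in>\<rat>. z j < r \<and> r < z j + e" by (intro allI Rats_dense_in_real) auto
    then obtain r where r: "\<And>j. r j \<in> \<rat>" "\<And>j. z j < r j" "\<And>j. r j < z j + e" by metis
    have "(INF z \<in> {..<k} \<rightarrow>\<^sub>E \<rat>. SC n k x z) \<le> SC n k x (restrict r {..<k})"
      using r by (intro cINF_lower bdd) auto
    also have "\<dots> \<le> SC n k x z + e"
    proof (intro SC_perturb k n)
      fix j assume "j < k"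
      then show "\<bar>restrict r {..<k} j - z j\<bar> \<le> e" using r(2)[of j] r(3)[of j] by simp
    qed
    finally show "(INF z \<in> {..<k} \<rightarrow>\<^sub>E \<rat>. SC n k x z) \<le> SC n k x z + e" .
  qed
qed

lemma (in real_distribution) measurable_SC:
  assumes [measurable]: "\<And>j. j < k \<Longrightarrow> (\<lambda>x. f x j) \<in> borel_measurable (PiM {..<n} (\<lambda>_. M))"
  shows "(\<lambda>x. SC n k x (f x)) \<in> borel_measurable (PiM {..<n} (\<lambda>_. M))"
  unfolding SC_def by measurable

lemma (in real_distribution) measurable_SC_opt:
  assumes "k \<ge> 1" "n \<ge> 1"
  shows "SC_opt n k \<in> borel_measurable (PiM {..<n} (\<lambda>_. M))"
proof -
  have "(\<lambda>x. INF z \<in> {..<k} \<rightarrow>\<^sub>E \<rat>. SC n k x z) \<in> borel_measurable (PiM {..<n} (\<lambda>_. M))"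
    by (intro borel_measurable_cINF_real measurable_SC countable_PiE) (auto simp: countable_rat)
  then show ?thesis using SC_opt_eq_INF_rational[OF assms] by (simp cong: measurable_cong)
qed

lemma (in real_distribution) measurable_percentile_mech:
  assumes "v j \<le> 1" "n \<ge> 1"
  shows "(\<lambda>x. percentile_mech v n x j) \<in> borel_measurable (PiM {..<n} (\<lambda>_. M))"
  unfolding borel_measurable_iff_le
proof
  fix a :: real
  let ?P = "PiM {..<n} (\<lambda>_. M)" and ?m = "nat \<lfloor>real (n - 1) * v j\<rfloor>"
  have card: "real (card {i. i < n \<and> x i \<le> a}) = (\<Sum>i<n. indicator {..a} (x i))" for x
    by (simp add: indicator_def sum.If_cases Int_def conj_commute)
  have "{x \<in> space ?P. percentile_mech v n x j \<le> a} = {x \<in> space ?P. real ?m < (\<Sum>i<n. indicator {..a} (x i))}"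
    unfolding card[symmetric] of_nat_less_iff
    using percentile_mech_iff_card[of v j n "\<lambda>u. u \<le> a"] assms by simp
  also have "\<dots> \<in> sets ?P" by measurable
  finally show "{x \<in> space ?P. percentile_mech v n x j \<le> a} \<in> sets ?P" .
qed

section \<open>Convergence of the expected costs and of their ratio\<close>

lemma (in real_distribution) expected_costs_tendsto:
  assumes int: "integrable M (\<lambda>t. t)" and k: "k \<ge> 1" and atomless: "\<And>c. AE t in M. t \<noteq> c"
    and interval: "is_interval (msupport M)"
    and opt: "\<And>z. (\<integral>t. nearest_dist k y t \<partial>M) \<le> (\<integral>t. nearest_dist k z t \<partial>M)"
    and v: "\<And>j. v j = cdf M (y j)"
  shows "(\<lambda>n. \<integral>x. SC n k x (percentile_mech v n x) \<partial>PiM {..<n} (\<lambda>_. M))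
      \<longlonglongrightarrow> (\<integral>t. nearest_dist k y t \<partial>M)" (is "?A \<longlonglongrightarrow> ?m")
    and "(\<lambda>n. \<integral>x. SC_opt n k x \<partial>PiM {..<n} (\<lambda>_. M)) \<longlonglongrightarrow> (\<integral>t. nearest_dist k y t \<partial>M)" (is "?B \<longlonglongrightarrow> _")
proof -
  let ?S = "msupport M"
  have S: "closed ?S" "?S \<noteq> {}" "convex ?S"
    using closed_msupport[OF events_eq_borel] msupport_nonempty interval by (auto simp: is_interval_convex_1)
  have AE_S: "AE t in M. t \<in> ?S" using AE_in_msupport[OF events_eq_borel] .
  define p where "p j = closest_point ?S (y j)" for j
  have p: "p j \<in> ?S" "v j = cdf M (p j)" for j
    using closest_point_in_set[OF S(1,2)] cdf_closest_point_msupport[OF S(2) atomless] by (auto simp: p_def v)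
  have v1: "v j \<le> 1" for j by (simp add: v cdf_def)
  have p_le: "(\<integral>t. nearest_dist k p t \<partial>M) \<le> ?m"
  \<comment> \<open>Projection onto the closed convex support is nonexpansive and fixes almost every
    \<open>t\<close>, so it brings no facility further from \<open>t\<close>.\<close>
  proof (rule integral_mono_AE[OF integrable_nearest_dist[OF int k] integrable_nearest_dist[OF int k]])
    show "AE t in M. nearest_dist k p t \<le> nearest_dist k y t" using AE_S
    proof eventually_elim
      case (elim t)
      have "\<bar>t - p j\<bar> \<le> \<bar>t - y j\<bar>" for j
        using closest_point_lipschitz[OF S(3,1,2), of t "y j"] closest_point_self[OF elim]
        by (simp add: p_def dist_real_def)
      then show ?case using nearest_dist_perturb[OF k, of t p t y 0] by simp
    qed
  qed
  have main: "\<exists>N. \<forall>n\<ge>N. ?m - r \<le> ?B n \<and> ?B n \<le> ?A n \<and> ?A n \<le> ?m + r" if r: "r > 0" for r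
  proof -
    define \<epsilon> where "\<epsilon> = r / 2"
    have \<epsilon>: "\<epsilon> > 0" using r by (simp add: \<epsilon>_def)
    have "\<forall>j. \<exists>d>0. (\<forall>q\<in>?S. q > p j + \<epsilon> \<longrightarrow> cdf M (p j + \<epsilon>) \<ge> cdf M (p j) + d) \<and>
        (\<forall>q\<in>?S. q < p j - \<epsilon> \<longrightarrow> cdf M (p j - \<epsilon>) \<le> cdf M (p j) - d)"
      using cdf_gap[OF interval p(1) \<epsilon>] by metis
    then obtain d where d: "\<And>j. d j > 0"
        "\<And>j q. q \<in> ?S \<Longrightarrow> q > p j + \<epsilon> \<Longrightarrow> cdf M (p j + \<epsilon>) \<ge> cdf M (p j) + d j"
        "\<And>j q. q \<in> ?S \<Longrightarrow> q < p j - \<epsilon> \<Longrightarrow> cdf M (p j - \<epsilon>) \<le> cdf M (p j) - d j"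
      by metis
    define \<delta> where "\<delta> = Min (d ` {..<k})"
    have \<delta>: "\<delta> > 0" "\<And>j. j < k \<Longrightarrow> \<delta> \<le> d j"
      using k d(1) by (auto simp: \<delta>_def lessThan_empty_iff)
    \<comment> \<open>The coefficient of \<open>U\<close> in the upper bound: 1 for passing from the
      sample cost at \<open>p\<close> to its expectation, and \<open>2 / \<delta>\<close> for the
      displacement of the percentiles. With \<open>\<eta> = r / (2 * K)\<close> this costs
      \<open>r / 2\<close>, and \<open>\<epsilon>\<close> accounts for the other half of
      \<open>r\<close>.\<close>
    define K where "K = 1 + 2 / \<delta>"
    have K: "K \<ge> 1" using \<delta> by (simp add: K_def)
    define \<eta> where "\<eta> = r / (2 * K)"
    have \<eta>: "\<eta> > 0" "K * \<eta> = r / 2" using r K by (auto simp: \<eta>_def)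
    have "1 * \<eta> \<le> K * \<eta>" using K \<eta> by (intro mult_right_mono) auto
    then have \<eta>_le: "\<eta> \<le> r" using \<eta> r by simp
    obtain U :: "nat \<Rightarrow> (nat \<Rightarrow> real) \<Rightarrow> real" and N :: nat where N: "N \<ge> 1"
      and int_U: "\<And>n. n \<ge> N \<Longrightarrow> integrable (PiM {..<n} (\<lambda>_. M)) (U n)"
      and E_U: "\<And>n. n \<ge> N \<Longrightarrow> (\<integral>x. U n x \<partial>PiM {..<n} (\<lambda>_. M)) \<le> \<eta>"
      and U: "\<And>n x g. n \<ge> N \<Longrightarrow> 1-lipschitz_on UNIV g \<Longrightarrow>
        \<bar>(\<Sum>i<n. g (x i)) / n - (\<integral>t. g t \<partial>M)\<bar> \<le> U n x"
      by (rule uniform_lipschitz_mean[OF int \<eta>(1)], rule that)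
    have "?m - r \<le> ?B n \<and> ?B n \<le> ?A n \<and> ?A n \<le> ?m + r" if n: "n \<ge> max N (nat \<lceil>2 / \<delta>\<rceil>)" for n
    proof -
      let ?P = "PiM {..<n} (\<lambda>_. M)" and ?q = "percentile_mech v n"
      interpret P: prob_space ?P by (rule prob_space_sample)
      have n': "n \<ge> N" "n \<ge> 1" "n \<ge> 2 / \<delta>" using n N by (auto simp: nat_le_iff ceiling_le_iff)
      have SC_U: "\<bar>SC n k x z - (\<integral>t. nearest_dist k z t \<partial>M)\<bar> \<le> U n x" for x z
        unfolding SC_eq by (intro U n' nearest_dist_lipschitz k)
      have lower: "?m - U n x \<le> SC_opt n k x" for x
      proof (rule SC_opt_ge)
        fix z show "?m - U n x \<le> SC n k x z" using SC_U[of x z] opt[of z] by linarith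
      qed
      have upper: "AE x in ?P. SC n k x (?q x) \<le> ?m + \<epsilon> + K * U n x"
        using AE_sample[OF AE_S, of n]
      proof eventually_elim
        case (elim x)
        have "\<bar>?q x j - p j\<bar> \<le> \<epsilon> + 2 * U n x / \<delta>" if j: "j < k" for j
        proof (rule percentile_mech_close[where v = v and j = j])
          \<comment> \<open>Each facility of the mechanism is a report, hence almost surely in the
            support; this makes the conditional bounds on the c.d.f. available.\<close>
          have q: "?q x j \<in> ?S" using percentile_mech_in_sample[of v j n x] v1 n'(2) elim by auto
          show "cdf M (p j + \<epsilon>) \<ge> cdf M (p j) + \<delta>" if "?q x j > p j + \<epsilon>"
            using d(2)[OF q that] \<delta>(2)[OF j] by linarith
          show "cdf M (p j - \<epsilon>) \<le> cdf M (p j) - \<delta>" if "?q x j < p j - \<epsilon>"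
            using d(3)[OF q that] \<delta>(2)[OF j] by linarith
        qed (use \<delta>(1) \<epsilon> p(2) U n' in auto)
        then have "SC n k x (?q x) \<le> SC n k x p + (\<epsilon> + 2 * U n x / \<delta>)"
          by (intro SC_perturb k n')
        then show ?case using SC_U[of x p] p_le by (simp add: K_def algebra_simps)
      qed
      have meas_A: "(\<lambda>x. SC n k x (?q x)) \<in> borel_measurable ?P"
        by (intro measurable_SC measurable_percentile_mech v1 n')
      have int_b: "integrable ?P (\<lambda>x. ?m + \<epsilon> + K * U n x)" using int_U[OF n'(1)] by simp
      \<comment> \<open>The pointwise upper bound by an affine function of \<open>U\<close> also
        supplies the integrable majorant, and this cost in turn majorises
        \<open>SC_opt\<close>.\<close>
      have int_A: "integrable ?P (\<lambda>x. SC n k x (?q x))"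
        using int_b meas_A
      proof (rule Bochner_Integration.integrable_bound)
        show "AE x in ?P. norm (SC n k x (?q x)) \<le> norm (?m + \<epsilon> + K * U n x)"
          using upper by eventually_elim (use SC_nonneg[OF k] in auto)
      qed
      have opt0: "0 \<le> SC_opt n k x" for x by (intro SC_opt_ge SC_nonneg k)
      have int_B: "integrable ?P (SC_opt n k)"
        using int_A measurable_SC_opt[OF k n'(2)]
      proof (rule Bochner_Integration.integrable_bound)
        show "AE x in ?P. norm (SC_opt n k x) \<le> norm (SC n k x (?q x))"
          using SC_opt_le[OF k] opt0 SC_nonneg[OF k] by auto
      qed
      have "?m - \<eta> \<le> (\<integral>x. ?m - U n x \<partial>?P)"
        using E_U[OF n'(1)] int_U[OF n'(1)] by (simp add: P.prob_space)
      also have "\<dots> \<le> ?B n" using int_U[OF n'(1)] int_B lower by (intro integral_mono) auto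
      finally have 1: "?m - r \<le> ?B n" using \<eta>_le by linarith
      have 2: "?B n \<le> ?A n" using int_A int_B SC_opt_le[OF k] by (intro integral_mono) auto
      have "?A n \<le> (\<integral>x. ?m + \<epsilon> + K * U n x \<partial>?P)"
        using int_A int_b upper by (rule integral_mono_AE)
      also have "\<dots> = ?m + \<epsilon> + K * (\<integral>x. U n x \<partial>?P)"
        using int_U[OF n'(1)] by (simp add: P.prob_space)
      also have "\<dots> \<le> ?m + \<epsilon> + K * \<eta>" using E_U[OF n'(1)] K by (intro add_left_mono mult_left_mono) auto
      finally have "?A n \<le> ?m + r" using \<eta>(2) by (simp add: \<epsilon>_def)
      with 1 2 show ?thesis by blast
    qed
    then show ?thesis by blast
  qed
  have close: "\<exists>N. \<forall>n\<ge>N. norm (?A n - ?m) < r \<and> norm (?B n - ?m) < r" if r: "r > 0" for r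
  proof -
    have "r / 2 > 0" using r by simp
    from main[OF this] obtain N
      where N: "\<forall>n\<ge>N. ?m - r / 2 \<le> ?B n \<and> ?B n \<le> ?A n \<and> ?A n \<le> ?m + r / 2" ..
    have "norm (?A n - ?m) < r \<and> norm (?B n - ?m) < r" if "n \<ge> N" for n
      using N[rule_format, OF that] r unfolding real_norm_def by linarith
    then show ?thesis by blast
  qed
  show "?A \<longlonglongrightarrow> ?m"
  proof (rule LIMSEQ_I)
    fix r :: real assume "r > 0"
    from close[OF this] show "\<exists>N. \<forall>n\<ge>N. norm (?A n - ?m) < r" by blast
  qed
  show "?B \<longlonglongrightarrow> ?m"
  proof (rule LIMSEQ_I)
    fix r :: real assume "r > 0"
    from close[OF this] show "\<exists>N. \<forall>n\<ge>N. norm (?B n - ?m) < r" by blast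
  qed
qed

theorem theorem5:
  fixes \<mu> :: "real measure" and \<rho> :: "real \<Rightarrow> real" and k :: nat
    and L :: "real measure" and y :: "nat \<Rightarrow> real"
  assumes "standing_assms \<mu> \<rho>"
    and "integrable \<mu> (\<lambda>x. \<bar>x\<bar>)"
    and "k \<ge> 1"
    and "L \<in> Pk k"
    and "\<forall>L' \<in> Pk k. W1 \<mu> L \<le> W1 \<mu> L'"
    and "\<forall>i j. i \<le> j \<longrightarrow> j < k \<longrightarrow> y i \<le> y j"
    and "msupport L = y ` {..<k}"
  shows "optimal_percentile \<mu> k (\<lambda>j. cdf \<mu> (y j))"
proof -
  have \<mu>: "prob_space \<mu>" "\<rho> \<in> borel_measurable borel" "\<mu> = density lborel (\<lambda>x. ennreal (\<rho> x))"
    and interval: "is_interval (msupport \<mu>)"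
    using assms(1) by (auto simp: standing_assms_def)
  interpret prob_space \<mu> by (rule \<mu>)
  interpret real_distribution \<mu> by standard (subst \<mu>(3), simp)
  have int: "integrable \<mu> (\<lambda>t. t)" using assms(2) by (rule integrable_abs_cancel) simp
  have atomless: "AE t in \<mu>. t \<noteq> c" for c
    unfolding \<mu>(3) using \<mu>(2) AE_lborel_singleton[of c] by (subst AE_density) auto
  note opt = optimal_support_minimizes[OF int assms(3,4,5,7)]
  note lim = expected_costs_tendsto[OF int assms(3) atomless interval opt, of "\<lambda>j. cdf \<mu> (y j)"]
  \<comment> \<open>Numerator and denominator have the same limit, which is positive because
    \<open>\<mu>\<close> has no atoms.\<close>
  have "(\<lambda>n. B_ar \<mu> k n (percentile_mech (\<lambda>j. cdf \<mu> (y j))))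
      \<longlonglongrightarrow> (\<integral>t. nearest_dist k y t \<partial>\<mu>) / (\<integral>t. nearest_dist k y t \<partial>\<mu>)"
    unfolding B_ar_def using lim integral_nearest_dist_pos[OF int assms(3) atomless, of y]
    by (intro tendsto_divide) auto
  then have "(\<lambda>n. B_ar \<mu> k n (percentile_mech (\<lambda>j. cdf \<mu> (y j)))) \<longlonglongrightarrow> 1"
    using integral_nearest_dist_pos[OF int assms(3) atomless, of y] by simp
  moreover have "0 \<le> cdf \<mu> t" "cdf \<mu> t \<le> 1" for t by (auto simp: cdf_def)
  ultimately show ?thesis
    using assms(6) by (auto simp: optimal_percentile_def intro: cdf_mono)
qed

end
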